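(* Let $$\mathcal B:=\{0\}\cup\{|t_{ij}|:\ i=1,\dots,n,\ x_{i,j}\in\mathcal X_i^{\mathrm{ad}}\}.$$ If the discrete robust problem is feasible, then there exists an optimal solution $(\bm{x}^\star,\theta^\star)$ with $\theta^\star\in\mathcal B$; that is, there are an optimal solution $\bm{x}^\star$ of the discrete robust problem and $\theta^\star\in\mathcal B$ such that $$\sum_{i=1}^n\Big(s_i(x_i^\star)-\max\{0,\ |t_i(x_i^\star)|-\theta^\star\}\Big)\ge\Gamma\theta^\star .$$
   Context: Data. There are items $i=1,\dots,n$. Item $i$ has a finite price menu $\mathcal X_i=\{x_{i,1},\dots,x_{i,m}\}\subset\mathbb R$, a reference price $a_i>0$, an exposure $\omega_i>0$, a nominal demand function $\hat g_i:\mathcal X_i\to\mathbb R_{>0}$ (monotone decreasing on the admissible range), and a relative tolerance $\sigma_i$. A margin target $\Delta>0$ and an integer budget $\Gamma\in\{0,1,\dots,n\}$ are given. The admissible menu $\mathcal X_i^{\mathrm{ad}}=\mathcal X_i\cap[(1-\sigma_i)a_i,(1+\sigma_i)a_i]$ is assumed nonempty. A variability parameter $\delta_i(x_i)$ is given with $0\le\delta_i(x_i)<\hat g_i(x_i)$ on $\mathcal X_i^{\mathrm{ad}}$. Put $s_i(x_i)=\omega_i(x_i-\Delta a_i)\hat g_i(x_i)$, $t_i(x_i)=\omega_i(x_i-\Delta a_i)\delta_i(x_i)$, and $t_{ij}=t_i(x_{i,j})$ for admissible options. Let $\beta(\bm{x},\Gamma)$ be the sum of the $\Gamma$ largest values among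 $\{|t_i(x_i)|\}_{i=1}^n$ (with $\beta(\bm{x},0)=0$). The discrete robust problem is: maximize $N(\bm{x})=\sum_{i=1}^n\omega_i x_i\hat g_i(x_i)$ over $\bm{x}$ with $x_i\in\mathcal X_i^{\mathrm{ad}}$ for all $i$, subject to the robust margin constraint $\sum_{i=1}^n s_i(x_i)-\beta(\bm{x},\Gamma)\ge0$. This constraint is equivalent to the existence of $\theta\ge0$ with $\sum_{i=1}^n(s_i(x_i)-\max\{0,|t_i(x_i)|-\theta\})\ge\Gamma\theta$, so the problem may also be viewed as maximizing $N(\bm{x})$ over pairs $(\bm{x},\theta)$, $\theta\ge0$, satisfying this inequality. *)

theory Defs
  imports "HOL-Analysis.Analysis"
begin

text \<open>
  Items are \<open>1..items\<close> and the menu of item \<open>i\<close> is the set of the prices \<open>price i j\<close>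
  with \<open>j\<close> in \<open>1..options\<close>. The functions \<open>demand i\<close> and \<open>dev i\<close> are total; only their
  values on the (admissible) menu of item \<open>i\<close> matter.
\<close>

record pricing_data =
  items :: nat
  options :: nat
  price :: "nat \<Rightarrow> nat \<Rightarrow> real"
  ref_price :: "nat \<Rightarrow> real"
  exposure :: "nat \<Rightarrow> real"
  demand :: "nat \<Rightarrow> real \<Rightarrow> real"
  tol :: "nat \<Rightarrow> real"
  margin_target :: real
  budget :: nat
  dev :: "nat \<Rightarrow> real \<Rightarrow> real"

definition menu :: "pricing_data \<Rightarrow> nat \<Rightarrow> real set" where
  "menu D i = price D i ` {1..options D}"

definition adm_menu :: "pricing_data \<Rightarrow> nat \<Rightarrow> real set" where
  "adm_menu D i =
     menu D i \<inter> {(1 - tol D i) * ref_price D i .. (1 + tol D i) * ref_price D i}"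

definition pricing_instance :: "pricing_data \<Rightarrow> bool" where
  "pricing_instance D \<longleftrightarrow>
     margin_target D > 0 \<and>
     budget D \<le> items D \<and>
     (\<forall>i\<in>{1..items D}.
        ref_price D i > 0 \<and>
        exposure D i > 0 \<and>
        (\<forall>p\<in>menu D i. demand D i p > 0) \<and>
        antimono_on (adm_menu D i) (demand D i) \<and>
        adm_menu D i \<noteq> {} \<and>
        (\<forall>p\<in>adm_menu D i. 0 \<le> dev D i p \<and> dev D i p < demand D i p))"

definition s_val :: "pricing_data \<Rightarrow> nat \<Rightarrow> real \<Rightarrow> real" where
  "s_val D i p = exposure D i * (p - margin_target D * ref_price D i) * demand D i p"

definition t_val :: "pricing_data \<Rightarrow> nat \<Rightarrow> real \<Rightarrow> real" where
  "t_val D i p = exposure D i * (p - margin_target D * ref_price D i) * dev D i p"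

text \<open>The values \<open>\<bar>t\<^sub>i(x\<^sub>i)\<bar>\<close> are counted with multiplicity.\<close>

definition beta :: "pricing_data \<Rightarrow> (nat \<Rightarrow> real) \<Rightarrow> nat \<Rightarrow> real" where
  "beta D x k =
     sum_list (take k (rev (sort (map (\<lambda>i. \<bar>t_val D i (x i)\<bar>) [1..<Suc (items D)]))))"

definition revenue :: "pricing_data \<Rightarrow> (nat \<Rightarrow> real) \<Rightarrow> real" where
  "revenue D x = (\<Sum>i=1..items D. exposure D i * x i * demand D i (x i))"

text \<open>
  Price vectors are extensional functions on the items, so that each one
  represents exactly one point of the product of the admissible menus.
\<close>

definition adm_prices :: "pricing_data \<Rightarrow> (nat \<Rightarrow> real) set" where
  "adm_prices D = (\<Pi>\<^sub>E i\<in>{1..items D}. adm_menu D i)"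

definition robust_feasible :: "pricing_data \<Rightarrow> (nat \<Rightarrow> real) \<Rightarrow> bool" where
  "robust_feasible D x \<longleftrightarrow>
     x \<in> adm_prices D \<and>
     (\<Sum>i=1..items D. s_val D i (x i)) - beta D x (budget D) \<ge> 0"

definition robust_optimal :: "pricing_data \<Rightarrow> (nat \<Rightarrow> real) \<Rightarrow> bool" where
  "robust_optimal D x \<longleftrightarrow> is_arg_max (revenue D) (robust_feasible D) x"

definition theta_constraint :: "pricing_data \<Rightarrow> (nat \<Rightarrow> real) \<Rightarrow> real \<Rightarrow> bool" where
  "theta_constraint D x \<theta> \<longleftrightarrow>
     (\<Sum>i=1..items D. s_val D i (x i) - max 0 (\<bar>t_val D i (x i)\<bar> - \<theta>)) \<ge> real (budget D) * \<theta>"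

definition theta_feasible :: "pricing_data \<Rightarrow> (nat \<Rightarrow> real) \<times> real \<Rightarrow> bool" where
  "theta_feasible D = (\<lambda>(x, \<theta>). x \<in> adm_prices D \<and> \<theta> \<ge> 0 \<and> theta_constraint D x \<theta>)"

definition theta_optimal :: "pricing_data \<Rightarrow> (nat \<Rightarrow> real) \<times> real \<Rightarrow> bool" where
  "theta_optimal D z \<longleftrightarrow> is_arg_max (\<lambda>(x, \<theta>). revenue D x) (theta_feasible D) z"

definition breakpoints :: "pricing_data \<Rightarrow> real set" where
  "breakpoints D =
     {0} \<union> {\<bar>t_val D i (price D i j)\<bar> | i j.
              i \<in> {1..items D} \<and> j \<in> {1..options D} \<and> price D i j \<in> adm_menu D i}"

end

theory Submission
  imports Defs
begin

text \<open>
  For a fixed price vector, the sum of the \<open>k\<close> largest deviations is the minimum over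
  \<open>\<theta> \<ge> 0\<close> of the piecewise linear convex function
  \<open>k * \<theta> + (\<Sum>i. max 0 (\<bar>t\<^sub>i\<bar> - \<theta>))\<close>; this is linear programming duality for the
  choice of \<open>k\<close> items with the largest total. The slope of this function is \<open>k\<close> minus the
  number of deviations above \<open>\<theta>\<close>, so the minimum is attained where that number drops to
  \<open>k\<close> or below, namely at the \<open>(k+1)\<close>-st largest deviation, or at \<open>0\<close> if there are only \<open>k\<close> items.
  That minimizer is always a breakpoint.

  The two halves of the duality are \<open>sum_take_le_threshold\<close> (every \<open>\<theta> \<ge> 0\<close> gives an upper
  bound) and \<open>sum_take_eq_threshold\<close> (the bound is attained at the stated place). The first
  half makes the price part of every feasible pair \<open>(x, \<theta>)\<close> robustly feasible; the second
  completes every robustly feasible \<open>x\<close> to a feasible pair with \<open>\<theta>\<close> a breakpoint. Since the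
  objective ignores \<open>\<theta>\<close>, a robust optimum, which exists because there are finitely many
  admissible price vectors, becomes an optimal pair in this way.
\<close>

text \<open>
  Each selected entry satisfies \<open>y \<le> \<theta> + max 0 (y - \<theta>)\<close>, and the entries left out, as well
  as a number \<open>k\<close> beyond the length, only enlarge the right-hand side.
\<close>

lemma sum_take_le_threshold:
  fixes ys :: "real list"
  assumes "\<theta> \<ge> 0"
  shows "sum_list (take k ys) \<le> real k * \<theta> + (\<Sum>y\<leftarrow>ys. max 0 (y - \<theta>))"
proof (induction ys arbitrary: k)
  case Nil
  then show ?case using assms by simp
next
  case (Cons y ys)
  show ?case
  proof (cases k)
    case 0
    have "0 \<le> (\<Sum>y\<leftarrow>y # ys. max 0 (y - \<theta>))"
      by (intro sum_list_nonneg) auto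
    with 0 show ?thesis by simp
  next
    case (Suc l)
    with Cons.IH[of l] show ?thesis by (simp add: algebra_simps)
  qed
qed

text \<open>
  At the first entry left out, or at \<open>0\<close> when none is, the selected entries are at least \<open>\<theta>\<close> and the others at most
  \<open>\<theta>\<close>, so every estimate in the previous lemma is an equality.
\<close>

lemma sum_take_eq_threshold:
  fixes ys :: "real list"
  assumes "sorted_wrt (\<ge>) ys" and "\<And>y. y \<in> set ys \<Longrightarrow> y \<ge> 0" and "k \<le> length ys"
    and "\<theta> = (if k < length ys then ys ! k else 0)"
  shows "sum_list (take k ys) = real k * \<theta> + (\<Sum>y\<leftarrow>ys. max 0 (y - \<theta>))"
  using assms
proof (induction ys arbitrary: k)
  case Nil
  then show ?case by simp
next
  case (Cons y ys)
  show ?case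
  proof (cases k)
    case 0
    with Cons.prems have "\<And>z. z \<in> set (y # ys) \<Longrightarrow> max 0 (z - \<theta>) = 0"
      by auto
    then have "(\<Sum>z\<leftarrow>y # ys. max 0 (z - \<theta>)) = (\<Sum>z\<leftarrow>y # ys. 0)"
      by (intro arg_cong[where f = sum_list] map_cong) auto
    with 0 show ?thesis by simp
  next
    case (Suc l)
    have "sum_list (take l ys) = real l * \<theta> + (\<Sum>y\<leftarrow>ys. max 0 (y - \<theta>))"
      using Cons.prems Suc by (intro Cons.IH) auto
    moreover have "\<theta> \<le> y"
      using Cons.prems Suc by auto
    ultimately show ?thesis using Suc by (simp add: algebra_simps)
  qed
qed

definition sorted_devs :: "pricing_data \<Rightarrow> (nat \<Rightarrow> real) \<Rightarrow> real list" where
  "sorted_devs D x = rev (sort (map (\<lambda>i. \<bar>t_val D i (x i)\<bar>) [1..<Suc (items D)]))"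

lemma set_sorted_devs: "set (sorted_devs D x) = (\<lambda>i. \<bar>t_val D i (x i)\<bar>) ` {1..items D}"
  by (simp add: sorted_devs_def atLeastLessThanSuc_atLeastAtMost del: upt_Suc)

lemma length_sorted_devs: "length (sorted_devs D x) = items D"
  by (simp add: sorted_devs_def del: upt_Suc)

lemma sum_sorted_devs:
  "(\<Sum>y\<leftarrow>sorted_devs D x. h y) = (\<Sum>i=1..items D. h \<bar>t_val D i (x i)\<bar>)" for h :: "real \<Rightarrow> real"
proof -
  have "(\<Sum>y\<leftarrow>sorted_devs D x. h y) = (\<Sum>i\<leftarrow>[1..<Suc (items D)]. h \<bar>t_val D i (x i)\<bar>)"
    unfolding sum_mset_sum_list[symmetric] sorted_devs_def
    by (simp add: multiset.map_comp comp_def del: upt_Suc)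
  also have "\<dots> = (\<Sum>i=1..items D. h \<bar>t_val D i (x i)\<bar>)"
    by (simp add: sum_list_distinct_conv_sum_set atLeastLessThanSuc_atLeastAtMost del: upt_Suc)
  finally show ?thesis .
qed

lemma theta_constraint_iff:
  "theta_constraint D x \<theta> \<longleftrightarrow>
    real (budget D) * \<theta> + (\<Sum>y\<leftarrow>sorted_devs D x. max 0 (y - \<theta>)) \<le> (\<Sum>i=1..items D. s_val D i (x i))"
  by (auto simp: theta_constraint_def sum_sorted_devs sum_subtractf)

lemma robust_feasible_iff:
  "robust_feasible D x \<longleftrightarrow>
    x \<in> adm_prices D \<and> sum_list (take (budget D) (sorted_devs D x)) \<le> (\<Sum>i=1..items D. s_val D i (x i))"
  by (simp add: robust_feasible_def beta_def sorted_devs_def)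

lemma theta_feasible_imp_robust_feasible:
  assumes "theta_feasible D (x, \<theta>)"
  shows "robust_feasible D x"
  using assms sum_take_le_threshold[of \<theta> "budget D" "sorted_devs D x"]
  by (auto simp: theta_feasible_def theta_constraint_iff robust_feasible_iff)

lemma breakpoints_nonneg: "\<theta> \<in> breakpoints D \<Longrightarrow> \<theta> \<ge> 0"
  by (auto simp: breakpoints_def)

lemma sorted_devs_subset_breakpoints:
  assumes "x \<in> adm_prices D"
  shows "set (sorted_devs D x) \<subseteq> breakpoints D"
proof
  fix y
  assume "y \<in> set (sorted_devs D x)"
  then obtain i where i: "i \<in> {1..items D}" "y = \<bar>t_val D i (x i)\<bar>"
    by (auto simp: set_sorted_devs)
  have adm: "x i \<in> adm_menu D i"
    using assms i by (auto simp: adm_prices_def)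
  then obtain j where "j \<in> {1..options D}" "x i = price D i j"
    by (auto simp: adm_menu_def menu_def)
  with i adm show "y \<in> breakpoints D"
    unfolding breakpoints_def by auto
qed

text \<open>
  The witness is the \<open>(budget D + 1)\<close>-st largest deviation, or \<open>0\<close> when the budget covers
  all items: there the dual bound on the worst-case loss is tight.
\<close>

lemma robust_feasible_imp_breakpoint:
  assumes "budget D \<le> items D" and "robust_feasible D x"
  obtains \<theta> where "\<theta> \<in> breakpoints D" and "theta_feasible D (x, \<theta>)"
proof -
  let ?ys = "sorted_devs D x"
  define \<theta> where "\<theta> = (if budget D < length ?ys then ?ys ! budget D else 0)"
  have adm: "x \<in> adm_prices D"
    using assms by (simp add: robust_feasible_iff)
  have break: "\<theta> \<in> breakpoints D"
  proof (cases "budget D < length ?ys")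
    case True
    then have "\<theta> \<in> set ?ys" by (simp add: \<theta>_def)
    then show ?thesis using sorted_devs_subset_breakpoints[OF adm] by auto
  next
    case False
    then show ?thesis by (simp add: \<theta>_def breakpoints_def)
  qed
  have "sum_list (take (budget D) ?ys) = real (budget D) * \<theta> + (\<Sum>y\<leftarrow>?ys. max 0 (y - \<theta>))"
  proof (rule sum_take_eq_threshold)
    show "sorted_wrt (\<ge>) ?ys"
      by (simp add: sorted_devs_def sorted_wrt_rev del: upt_Suc)
    show "y \<ge> 0" if "y \<in> set ?ys" for y
      using that by (auto simp: set_sorted_devs)
    show "budget D \<le> length ?ys"
      using assms by (simp add: length_sorted_devs)
  qed (rule \<theta>_def)
  then have "theta_feasible D (x, \<theta>)"
    using assms(2) adm breakpoints_nonneg[OF break]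
    by (simp add: theta_feasible_def theta_constraint_iff robust_feasible_iff)
  with break show thesis by (rule that)
qed

lemma finite_adm_prices: "finite (adm_prices D)"
  unfolding adm_prices_def adm_menu_def menu_def by (intro finite_PiE) auto

lemma robust_optimal_exists:
  assumes "\<exists>x. robust_feasible D x"
  shows "\<exists>x. robust_optimal D x"
proof -
  let ?F = "{x. robust_feasible D x}"
  have fin: "finite ?F"
    by (rule finite_subset[OF _ finite_adm_prices[of D]]) (auto simp: robust_feasible_def)
  with assms have "Max (revenue D ` ?F) \<in> revenue D ` ?F"
    by (intro Max_in) auto
  then obtain x where x: "robust_feasible D x" "revenue D x = Max (revenue D ` ?F)"
    by auto
  have "revenue D y \<le> revenue D x" if "robust_feasible D y" for y
    using that fin by (simp add: x(2))
  with x(1) show ?thesis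
    by (auto simp: robust_optimal_def is_arg_max_linorder)
qed

theorem proposition7:
  fixes D :: pricing_data
  assumes "pricing_instance D"
    and "\<exists>x. robust_feasible D x"
  shows "\<exists>x \<theta>. \<theta> \<in> breakpoints D \<and>
    theta_optimal D (x, \<theta>) \<and>
    robust_optimal D x \<and>
    (\<Sum>i=1..items D. s_val D i (x i) - max 0 (\<bar>t_val D i (x i)\<bar> - \<theta>)) \<ge> real (budget D) * \<theta>"
proof -
  obtain x where opt: "robust_optimal D x"
    using robust_optimal_exists[OF assms(2)] by blast
  then have feas: "robust_feasible D x"
    and max: "\<And>y. robust_feasible D y \<Longrightarrow> revenue D y \<le> revenue D x"
    by (auto simp: robust_optimal_def is_arg_max_linorder)
  have "budget D \<le> items D"
    using assms(1) by (simp add: pricing_instance_def)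
  then obtain \<theta> where \<theta>: "\<theta> \<in> breakpoints D" "theta_feasible D (x, \<theta>)"
    using feas by (rule robust_feasible_imp_breakpoint)
  have "theta_optimal D (x, \<theta>)"
    unfolding theta_optimal_def is_arg_max_linorder
    using \<theta>(2) max theta_feasible_imp_robust_feasible by auto
  moreover have "theta_constraint D x \<theta>"
    using \<theta>(2) by (simp add: theta_feasible_def)
  ultimately show ?thesis
    using \<theta>(1) opt unfolding theta_constraint_def by blast
qed

end
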